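(* $NPO(4)=10$.
   Context: All graphs are finite, simple and undirected; $A(G)$ denotes the adjacency matrix of $G$. Eigenvalues are counted with multiplicity. For a positive integer $k$, $NPO(k)$ is the smallest integer $n$ such that the adjacency matrix of every graph with at least $n$ vertices has at least $k$ nonpositive eigenvalues. *)

theory Defs
  imports "Jordan_Normal_Form.Char_Poly"
begin

definition simple_graph :: "nat \<Rightarrow> (nat \<Rightarrow> nat \<Rightarrow> bool) \<Rightarrow> bool" where
  "simple_graph n E \<longleftrightarrow> (\<forall>i<n. \<forall>j<n. E i j = E j i) \<and> (\<forall>i<n. \<not> E i i)"

definition adj_matrix :: "nat \<Rightarrow> (nat \<Rightarrow> nat \<Rightarrow> bool) \<Rightarrow> real mat" where
  "adj_matrix n E = mat n n (\<lambda>(i,j). if E i j then 1 else 0)"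

text \<open>Number of nonpositive eigenvalues counted with (algebraic) multiplicity,
  i.e. number of nonpositive roots of the characteristic polynomial with multiplicity.
  A(G) is real symmetric, so all its eigenvalues are real.\<close>
definition num_nonpos_eigenvalues :: "real mat \<Rightarrow> nat" where
  "num_nonpos_eigenvalues A =
     (\<Sum>x\<in>{x. x \<le> 0 \<and> poly (char_poly A) x = 0}. order x (char_poly A))"

definition npo_property :: "nat \<Rightarrow> nat \<Rightarrow> bool" where
  "npo_property k n \<longleftrightarrow>
     (\<forall>m\<ge>n. \<forall>E. simple_graph m E \<longrightarrow> num_nonpos_eigenvalues (adj_matrix m E) \<ge> k)"

definition NPO :: "nat \<Rightarrow> nat" where
  "NPO k = (LEAST n. npo_property k n)"

end

(*
  At most three nonpositive eigenvalues means that the form x |-> x^T A x is nonpositive on no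
  4-dimensional subspace. By Ramsey a graph on 10 vertices contains K4 or three independent
  vertices; either one carries a 3-dimensional subspace W on which the form is nonpositive, so
  the form must be positive on the vectors y outside W that are orthogonal to W.

  For three independent vertices these y are the relations between the adjacency vectors, in
  {0,1}^3, of the remaining vertices. Hence these adjacency vectors are nonzero and pairwise
  distinct, and with 10 vertices all seven occur; the relations then force the edges between the
  remaining vertices until one relation has value 0. For K4 a Schur complement argument shows
  that the remaining vertices carry a positive definite matrix which up to signs is
  (3 I - J) / 3, so that at most two of them exist.
*)
theory Submission
  imports Defs "Jordan_Normal_Form.Schur_Decomposition" "Jordan_Normal_Form.Spectral_Radius"
begin

section \<open>Diagonalization of real symmetric matrices\<close>

text \<open>The spectrum over the complex numbers is nonempty. For a complex eigenvector v with
  eigenvalue k, the number conj(v)^T A v equals k |v|^2 and is its own conjugate because A is real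
  and symmetric. So k is real and a root of the real characteristic polynomial.\<close>

lemma real_symmetric_has_eigenvalue:
  fixes A :: "real mat"
  assumes A: "A \<in> carrier_mat n n" and sym: "transpose_mat A = A" and n: "n > 0"
  shows "\<exists>r. eigenvalue A r"
proof -
  let ?C = "map_mat complex_of_real A"
  have C: "?C \<in> carrier_mat n n" using A by auto
  obtain k where k: "eigenvalue ?C k"
    using spectrum_non_empty[OF C n] unfolding spectrum_def by auto
  then obtain v where v: "v \<in> carrier_vec n" "v \<noteq> 0\<^sub>v n" "?C *\<^sub>v v = k \<cdot>\<^sub>v v"
    using C unfolding eigenvalue_def eigenvector_def by auto
  have sym': "A $$ (i,j) = A $$ (j,i)" if "i < n" "j < n" for i j
    using arg_cong[OF sym, of "\<lambda>M. M $$ (i,j)"] that A by simp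
  have row: "(\<Sum>j<n. complex_of_real (A $$ (i,j)) * v $ j) = k * v $ i" if "i < n" for i
  proof -
    have "(?C *\<^sub>v v) $ i = (\<Sum>j<n. complex_of_real (A $$ (i,j)) * v $ j)"
      using that A v(1) by (simp add: scalar_prod_def lessThan_atLeast0)
    then show ?thesis using v that by simp
  qed
  define s where "s = (\<Sum>i<n. \<Sum>j<n. cnj (v $ i) * complex_of_real (A $$ (i,j)) * v $ j)"
  define N where "N = (\<Sum>i<n. (cmod (v $ i))\<^sup>2)"
  have "s = (\<Sum>i<n. cnj (v $ i) * (\<Sum>j<n. complex_of_real (A $$ (i,j)) * v $ j))"
    unfolding s_def by (simp add: sum_distrib_left mult.assoc)
  also have "\<dots> = (\<Sum>i<n. cnj (v $ i) * (k * v $ i))" by (simp add: row)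
  also have "\<dots> = k * complex_of_real N"
    unfolding N_def of_real_sum sum_distrib_left complex_norm_square
    by (intro sum.cong) (simp_all add: algebra_simps)
  finally have s: "s = k * complex_of_real N" .
  have "cnj s = (\<Sum>i<n. \<Sum>j<n. v $ i * complex_of_real (A $$ (i,j)) * cnj (v $ j))"
    unfolding s_def by simp
  also have "\<dots> = (\<Sum>j<n. \<Sum>i<n. v $ i * complex_of_real (A $$ (i,j)) * cnj (v $ j))"
    by (rule sum.swap)
  also have "\<dots> = s" unfolding s_def
    by (intro sum.cong refl) (use sym' in \<open>simp add: algebra_simps\<close>)
  finally have cs: "cnj s = s" .
  obtain i where i: "i < n" "v $ i \<noteq> 0" using v(1,2) by (metis eq_vecI carrier_vecD index_zero_vec)
  have "N > 0" unfolding N_def by (rule sum_pos2[of _ i]) (use i in auto)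
  with s cs have "cnj k = k" by simp
  then obtain r where r: "k = complex_of_real r" by (metis Reals_cnj_iff Reals_cases)
  have "poly (char_poly ?C) k = 0" using k C eigenvalue_root_char_poly by blast
  then have "poly (char_poly A) r = 0"
    unfolding of_real_hom.char_poly_hom[OF A] r by simp
  then show ?thesis using eigenvalue_root_char_poly[OF A] by blast
qed

text \<open>Gram-Schmidt, applied to a basis that starts with \<open>v\<close>, keeps
  \<open>v\<close> in first place; normalising the result gives the columns of \<open>W\<close>. The
  factor \<open>c\<close> is 1/|v|, and a multiple of an eigenvector is all that the diagonalization
  asks for.\<close>

lemma orthonormal_completion:
  fixes v :: "real vec"
  assumes v: "v \<in> carrier_vec n" and v0: "v \<noteq> 0\<^sub>v n"
  shows "\<exists>W c. W \<in> carrier_mat n n \<and> transpose_mat W * W = 1\<^sub>m n \<and> col W 0 = c \<cdot>\<^sub>v v"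
proof -
  interpret cof_vec_space n "TYPE(real)" .
  define ws where "ws = gram_schmidt n (basis_completion v)"
  note b = basis_completion[OF v v0]
  note gs = gram_schmidt_result[OF b(2) b(4) b(5) ws_def]
  have n: "n > 0" using v v0 by (cases n) auto
  have len: "length ws = n" using gs(4) b(6) by simp
  have c: "ws ! i \<in> carrier_vec n" if "i < n" for i using gs(3) len that by auto
  have hd: "ws ! 0 = v"
  proof -
    obtain xs where "basis_completion v = v # xs"
      using b(6,7) n by (cases "basis_completion v") auto
    then have "hd ws = v" unfolding ws_def using gram_schmidt_hd[OF v] by simp
    then show ?thesis using n len by (metis hd_conv_nth list.size(3) less_irrefl)
  qed
  \<comment> \<open>Conjugation is trivial over the reals, so \<open>corthogonal\<close> is plain
    orthogonality; its case i = j says that no vector has norm zero.\<close>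
  have orth: "(ws ! i \<bullet> ws ! j = 0) = (i \<noteq> j)" if "i < n" "j < n" for i j
    using corthogonalD[OF gs(2), of i j] len that by simp
  define d where "d i = sqrt (ws ! i \<bullet> ws ! i)" for i
  have d: "d i * d i = ws ! i \<bullet> ws ! i" for i
    unfolding d_def by (simp add: scalar_prod_def sum_nonneg)
  define W where "W = mat_of_cols n (map (\<lambda>i. (1 / d i) \<cdot>\<^sub>v ws ! i) [0..<n])"
  have W: "W \<in> carrier_mat n n" unfolding W_def by auto
  have colW: "col W i = (1 / d i) \<cdot>\<^sub>v ws ! i" if "i < n" for i
    unfolding W_def using that c by (subst col_mat_of_cols) auto
  have "transpose_mat W * W = 1\<^sub>m n"
  proof (rule eq_matI)
    fix i j assume "i < dim_row (1\<^sub>m n :: real mat)" "j < dim_col (1\<^sub>m n :: real mat)"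
    then have ij: "i < n" "j < n" by auto
    have "(transpose_mat W * W) $$ (i,j) = col W i \<bullet> col W j" using ij W by simp
    also have "\<dots> = (1 / d i) * (1 / d j) * (ws ! i \<bullet> ws ! j)"
      using ij c[OF ij(1)] c[OF ij(2)] by (simp add: colW)
    also have "\<dots> = (if i = j then 1 else 0)"
      using orth[OF ij] d[of i] by auto
    finally show "(transpose_mat W * W) $$ (i,j) = 1\<^sub>m n $$ (i,j)" using ij by simp
  qed (use W in auto)
  then show ?thesis using W colW[OF n] hd by auto
qed

text \<open>Induction on the size: in an orthonormal basis that starts with an eigenvector, the
  first column vanishes below the diagonal, symmetry clears the first row as well, and the remaining
  block is again symmetric.\<close>

lemma real_symmetric_diagonalization:
  fixes A :: "real mat"
  assumes "A \<in> carrier_mat n n" and "transpose_mat A = A"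
  shows "\<exists>U l. U \<in> carrier_mat n n \<and> transpose_mat U * U = 1\<^sub>m n
    \<and> A = U * mat n n (\<lambda>(i,j). if i = j then l i else 0) * transpose_mat U"
  using assms
proof (induction n arbitrary: A)
  case 0
  then show ?case by (intro exI[of _ A] exI[of _ "\<lambda>_. 0"]) (auto intro!: eq_matI)
next
  case (Suc n)
  note A = Suc.prems(1) and sym = Suc.prems(2)
  note square = assoc_mult_mat[of _ "Suc n" "Suc n" _ "Suc n" _ "Suc n"]
    mult_carrier_mat[of _ "Suc n" "Suc n" _ "Suc n"] transpose_mult[of _ "Suc n" "Suc n" _ "Suc n"]
  obtain e v where v: "v \<in> carrier_vec (Suc n)" "v \<noteq> 0\<^sub>v (Suc n)" "A *\<^sub>v v = e \<cdot>\<^sub>v v"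
    using real_symmetric_has_eigenvalue[OF A sym] A unfolding eigenvalue_def eigenvector_def by auto
  obtain W c where W: "W \<in> carrier_mat (Suc n) (Suc n)" "transpose_mat W * W = 1\<^sub>m (Suc n)"
    "col W 0 = c \<cdot>\<^sub>v v"
    using orthonormal_completion[OF v(1,2)] by auto
  have Wt: "transpose_mat W \<in> carrier_mat (Suc n) (Suc n)" using W by auto
  have WWt: "W * transpose_mat W = 1\<^sub>m (Suc n)"
    by (rule mat_mult_left_right_inverse[OF Wt W(1) W(2)])
  define A' where "A' = transpose_mat W * (A * W)"
  have A': "A' \<in> carrier_mat (Suc n) (Suc n)" unfolding A'_def using W A by auto
  have AA': "A = W * A' * transpose_mat W"
  proof -
    have "W * A' * transpose_mat W = (W * transpose_mat W) * A * (W * transpose_mat W)"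
      unfolding A'_def using W(1) Wt A by (simp add: square del: assoc_mult_mat)
    then show ?thesis using A by (simp add: WWt)
  qed
  have sym': "transpose_mat A' = A'"
    unfolding A'_def using W(1) Wt A sym
    by (simp add: square del: assoc_mult_mat)
  have col0: "A' $$ (i,0) = (if i = 0 then e else 0)" if i: "i < Suc n" for i
  proof -
    have "A' $$ (i,0) = col W i \<bullet> (A *\<^sub>v col W 0)"
      unfolding A'_def using i W(1) A by (simp add: mult_mat_vec_def)
    also have "A *\<^sub>v col W 0 = e \<cdot>\<^sub>v col W 0"
      unfolding W(3) mult_mat_vec[OF A v(1)] v(3) by (simp add: smult_smult_assoc mult.commute)
    also have "col W i \<bullet> (e \<cdot>\<^sub>v col W 0) = e * (transpose_mat W * W) $$ (i,0)"
      using i W(1) by simp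
    finally show ?thesis using i by (simp add: W(2))
  qed
  have row0: "A' $$ (0,j) = (if j = 0 then e else 0)" if "j < Suc n" for j
    using arg_cong[OF sym', of "\<lambda>M. M $$ (0,j)"] col0[OF that] that A' by simp
  define B where "B = mat n n (\<lambda>(i,j). A' $$ (Suc i, Suc j))"
  have B: "B \<in> carrier_mat n n" unfolding B_def by auto
  have "transpose_mat B = B"
  proof (rule eq_matI)
    fix i j assume "i < dim_row B" "j < dim_col B"
    then have ij: "i < n" "j < n" using B by auto
    then show "transpose_mat B $$ (i,j) = B $$ (i,j)"
      using arg_cong[OF sym', of "\<lambda>M. M $$ (Suc i, Suc j)"] A' by (simp add: B_def)
  qed (use B in auto)
  from Suc.IH[OF B this] obtain P l where P: "P \<in> carrier_mat n n" "transpose_mat P * P = 1\<^sub>m n"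
    "B = P * mat n n (\<lambda>(i,j). if i = j then l i else 0) * transpose_mat P" by auto
  define D where "D = mat n n (\<lambda>(i,j). if i = j then l i else 0)"
  have D: "D \<in> carrier_mat n n" unfolding D_def by auto
  have Pt: "transpose_mat P \<in> carrier_mat n n" using P by auto
  \<comment> \<open>\<open>F\<close> is the block sum of 1 and \<open>P\<close>, so
    \<open>W * F\<close> diagonalizes \<open>A\<close>; \<open>l'\<close> puts the eigenvalue
    \<open>e\<close> in front of those of the block.\<close>
  define F where "F = four_block_mat (1\<^sub>m 1) (0\<^sub>m 1 n) (0\<^sub>m n 1) P"
  define l' where "l' = case_nat e l"
  let ?D' = "mat (Suc n) (Suc n) (\<lambda>(i,j). if i = j then l' i else 0)"
  let ?E = "mat 1 1 (\<lambda>_. e)"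
  have F: "F \<in> carrier_mat (Suc n) (Suc n)" unfolding F_def using P by auto
  have Ft: "transpose_mat F = four_block_mat (1\<^sub>m 1) (0\<^sub>m 1 n) (0\<^sub>m n 1) (transpose_mat P)"
    unfolding F_def using P(1) by (subst transpose_four_block_mat) auto
  have FtF: "transpose_mat F * F = 1\<^sub>m (Suc n)"
  proof -
    have "transpose_mat F * F = four_block_mat (1\<^sub>m 1) (0\<^sub>m 1 n) (0\<^sub>m n 1) (1\<^sub>m n)"
      unfolding Ft unfolding F_def using P(1,2) Pt
      by (subst mult_four_block_mat[where ?nr1.0=1 and ?n1.0=1 and ?n2.0=n and ?nr2.0=n and ?nc1.0=1 and ?nc2.0=n]) auto
    also have "\<dots> = 1\<^sub>m (Suc n)" by (rule eq_matI) auto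
    finally show ?thesis .
  qed
  have D': "?D' = four_block_mat ?E (0\<^sub>m 1 n) (0\<^sub>m n 1) D"
    by (rule eq_matI) (auto simp: D_def l'_def split: nat.split)
  have A'B: "A' = four_block_mat ?E (0\<^sub>m 1 n) (0\<^sub>m n 1) B"
  proof (rule eq_matI)
    fix i j assume "i < dim_row (four_block_mat ?E (0\<^sub>m 1 n) (0\<^sub>m n 1) B)"
      "j < dim_col (four_block_mat ?E (0\<^sub>m 1 n) (0\<^sub>m n 1) B)"
    then have ij: "i < Suc n" "j < Suc n" using B by auto
    then show "A' $$ (i,j) = four_block_mat ?E (0\<^sub>m 1 n) (0\<^sub>m n 1) B $$ (i,j)"
      using B col0[OF ij(1)] row0[OF ij(2)] by (cases i; cases j) (auto simp: B_def)
  qed (use A' B in auto)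
  have A'F: "A' = F * ?D' * transpose_mat F"
  proof -
    have "F * ?D' = four_block_mat ?E (0\<^sub>m 1 n) (0\<^sub>m n 1) (P * D)"
      unfolding D' F_def using P(1) D
      by (subst mult_four_block_mat[where ?nr1.0=1 and ?n1.0=1 and ?n2.0=n and ?nr2.0=n and ?nc1.0=1 and ?nc2.0=n]) auto
    then have "F * ?D' * transpose_mat F = four_block_mat ?E (0\<^sub>m 1 n) (0\<^sub>m n 1) (P * D * transpose_mat P)"
      unfolding Ft using P(1) D Pt
      by (simp, subst mult_four_block_mat[where ?nr1.0=1 and ?n1.0=1 and ?n2.0=n and ?nr2.0=n and ?nc1.0=1 and ?nc2.0=n]) auto
    then show ?thesis unfolding A'B P(3) D_def by simp
  qed
  have Ft': "transpose_mat F \<in> carrier_mat (Suc n) (Suc n)" using F by auto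
  have D'': "?D' \<in> carrier_mat (Suc n) (Suc n)" by auto
  have 1: "transpose_mat (W * F) * (W * F) = 1\<^sub>m (Suc n)"
  proof -
    have "transpose_mat (W * F) * (W * F) = transpose_mat F * (transpose_mat W * W) * F"
      using W(1) Wt F Ft' by (simp add: square del: assoc_mult_mat)
    then show ?thesis using W(2) FtF Ft' by simp
  qed
  have 2: "A = W * F * ?D' * transpose_mat (W * F)"
  proof -
    have "A = W * (F * ?D' * transpose_mat F) * transpose_mat W"
      using AA' A'F by simp
    also have "\<dots> = W * F * ?D' * transpose_mat (W * F)"
      using W(1) Wt F Ft' D'' by (simp add: square del: assoc_mult_mat)
    finally show ?thesis .
  qed
  show ?case using 1 2 W(1) F by (intro exI[of _ "W * F"] exI[of _ l']) auto
qed

section \<open>The quadratic form and the number of nonpositive eigenvalues\<close>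

text \<open>Gaussian elimination: an equation with a nonzero coefficient at j0 determines the
  unknown j0, and subtracting multiples of it from the other equations removes one equation and one
  unknown. An equation with zero coefficients is dropped.\<close>

lemma homogeneous_system_nontrivial:
  fixes a :: "'a \<Rightarrow> 'b \<Rightarrow> 'c::field"
  assumes "finite I" and "finite J" and "card I < card J"
  shows "\<exists>c. (\<exists>j\<in>J. c j \<noteq> 0) \<and> (\<forall>i\<in>I. (\<Sum>j\<in>J. a i j * c j) = 0)"
  using assms
proof (induction I arbitrary: a J rule: finite_induct)
  case empty
  then have "J \<noteq> {}" by auto
  then show ?case by (intro exI[of _ "\<lambda>_. 1"]) auto
next
  case (insert i I)
  show ?case
  proof (cases "\<forall>j\<in>J. a i j = 0")
    case True
    then show ?thesis using insert.IH[of J a] insert.prems insert.hyps by auto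
  next
    case False
    then obtain j0 where j0: "j0 \<in> J" "a i j0 \<noteq> 0" by auto
    let ?J = "J - {j0}"
    define b where "b k j = a k j - a k j0 * a i j / a i j0" for k j
    have "card I < card ?J" using insert.prems insert.hyps j0 by simp
    with insert.IH[of ?J b] insert.prems obtain c where
      c: "\<exists>j\<in>?J. c j \<noteq> 0" "\<forall>k\<in>I. (\<Sum>j\<in>?J. b k j * c j) = 0" by auto
    define s where "s = (\<Sum>j\<in>?J. a i j * c j)"
    define c' where "c' = c(j0 := - s / a i j0)"
    have split: "(\<Sum>j\<in>J. a k j * c' j) = a k j0 * (- s / a i j0) + (\<Sum>j\<in>?J. a k j * c j)" for k
      using insert.prems j0 by (subst sum.remove[of J j0]) (auto simp: c'_def intro!: sum.cong)
    have "(\<Sum>j\<in>J. a k j * c' j) = 0" if k: "k \<in> I" for k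
    proof -
      have "0 = (\<Sum>j\<in>?J. a k j * c j - a k j0 / a i j0 * (a i j * c j))"
        using c(2) k unfolding b_def by (auto simp: algebra_simps)
      also have "\<dots> = (\<Sum>j\<in>?J. a k j * c j) - a k j0 / a i j0 * s"
        unfolding s_def sum_distrib_left by (rule sum_subtractf)
      finally show ?thesis unfolding split by simp
    qed
    moreover have "(\<Sum>j\<in>J. a i j * c' j) = 0" unfolding split using j0 by (simp add: s_def)
    moreover have "\<exists>j\<in>J. c' j \<noteq> 0" using c(1) by (auto simp: c'_def)
    ultimately show ?thesis by (intro exI[of _ c']) auto
  qed
qed

section \<open>Counting nonpositive eigenvalues through the quadratic form\<close>

definition bilin :: "real mat \<Rightarrow> (nat \<Rightarrow> real) \<Rightarrow> (nat \<Rightarrow> real) \<Rightarrow> real" where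
  "bilin A x y = (\<Sum>i<dim_row A. \<Sum>j<dim_row A. A $$ (i,j) * x i * y j)"

lemma order_prod_linear_factors:
  fixes l :: "nat \<Rightarrow> 'a::idom"
  shows "order x (\<Prod>k<n. [:- l k, 1:]) = card {k. k < n \<and> l k = x}"
proof (induction n)
  case 0
  then show ?case by (simp add: order_0I)
next
  case (Suc n)
  have nz: "(\<Prod>k<n. [:- l k, 1:]) \<noteq> 0" by simp
  have "{k. k < Suc n \<and> l k = x} = (if l n = x then insert n else id) {k. k < n \<and> l k = x}"
    by (auto simp: less_Suc_eq)
  then have "card {k. k < Suc n \<and> l k = x} = card {k. k < n \<and> l k = x} + (if l n = x then 1 else 0)"
    by auto
  moreover have "order x [:- l n, 1:] = (if l n = x then 1 else 0)"
    using order_power_n_n[of "l n" 1] by (auto simp: order_0I)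
  moreover
  have "(\<Prod>k<n. [:- l k, 1:]) * [:- l n, 1:] \<noteq> 0"
    using nz by (simp only: mult_eq_0_iff) simp
  from order_mult[OF this, of x]
  have "order x (\<Prod>k<Suc n. [:- l k, 1:]) = card {k. k < n \<and> l k = x} + order x [:- l n, 1:]"
    by (simp only: prod.lessThan_Suc Suc.IH)
  ultimately show ?case by simp
qed

text \<open>Orthogonal diagonalization in coordinates: \<open>l k\<close> is the k-th diagonal entry
  and \<open>u k\<close> its unit eigenvector. The two comparison lemmas below need only these sums
  and no matrix products. Similarity preserves the characteristic polynomial, which is therefore the
  product of the X - \<open>l k\<close>.\<close>

lemma num_nonpos_eigenvalues_diagonalization:
  assumes A: "A \<in> carrier_mat n n" and sym: "transpose_mat A = A"
  shows "\<exists>l u. num_nonpos_eigenvalues A = card {k. k < n \<and> l k \<le> 0}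
    \<and> (\<forall>x. bilin A x x = (\<Sum>k<n. l k * (\<Sum>i<n. u k i * x i)\<^sup>2))
    \<and> (\<forall>j<n. \<forall>k<n. (\<Sum>i<n. u j i * u k i) = (if j = k then 1 else 0))
    \<and> (\<forall>i<n. \<forall>j<n. (\<Sum>k<n. u k i * u k j) = (if i = j then 1 else 0))"
proof -
  define D :: "(nat \<Rightarrow> real) \<Rightarrow> real mat"
    where "D l = mat n n (\<lambda>(i,j). if i = j then l i else 0)" for l
  obtain U l where U: "U \<in> carrier_mat n n" "transpose_mat U * U = 1\<^sub>m n"
    and AU: "A = U * D l * transpose_mat U"
    using real_symmetric_diagonalization[OF A sym] unfolding D_def by auto
  have Ut: "transpose_mat U \<in> carrier_mat n n" using U by auto
  have D: "D l \<in> carrier_mat n n" unfolding D_def by auto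
  have UUt1: "U * transpose_mat U = 1\<^sub>m n"
    by (rule mat_mult_left_right_inverse[OF Ut U])
  define u where "u k i = U $$ (i,k)" for k i
  have "similar_mat_wit A (D l) U (transpose_mat U)"
    by (rule similar_mat_witI[OF UUt1 U(2) AU A D U(1) Ut])
  then have "char_poly A = char_poly (D l)"
    by (intro char_poly_similar) (auto simp: similar_mat_def)
  also have "\<dots> = (\<Prod>a\<leftarrow>diag_mat (D l). [:- a, 1:])"
    by (rule char_poly_upper_triangular[OF D]) (auto simp: D_def)
  also have "diag_mat (D l) = map l [0..<n]"
    by (auto simp: diag_mat_def D_def)
  also have "(\<Prod>a\<leftarrow>map l [0..<n]. [:- a, 1:]) = (\<Prod>k<n. [:- l k, 1:])"
    by (simp add: prod.list_conv_set_nth lessThan_atLeast0)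
  finally have cp: "char_poly A = (\<Prod>k<n. [:- l k, 1:])" .
  have roots: "{x. x \<le> 0 \<and> poly (char_poly A) x = 0} = l ` {k. k < n \<and> l k \<le> 0}"
    unfolding cp by (auto simp: poly_prod)
  \<comment> \<open>The multiplicity of a root x is the number of k with \<open>l k\<close> = x, so
    the sum over roots groups the indices k by the value of \<open>l\<close>.\<close>
  have "num_nonpos_eigenvalues A
      = (\<Sum>x\<in>l ` {k. k < n \<and> l k \<le> 0}. card {k. k < n \<and> l k = x})"
    unfolding num_nonpos_eigenvalues_def roots by (simp add: cp order_prod_linear_factors)
  also have "\<dots> = (\<Sum>x\<in>l ` {k. k < n \<and> l k \<le> 0}. \<Sum>k\<in>{k \<in> {k. k < n \<and> l k \<le> 0}. l k = x}. 1)"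
    by (intro sum.cong) (auto intro!: arg_cong[of _ _ card])
  also have "\<dots> = (\<Sum>k\<in>{k. k < n \<and> l k \<le> 0}. 1)"
    by (rule sum.group) auto
  finally have num: "num_nonpos_eigenvalues A = card {k. k < n \<and> l k \<le> 0}" by simp
  have entry: "A $$ (i,j) = (\<Sum>k<n. l k * u k i * u k j)" if ij: "i < n" "j < n" for i j
  proof -
    have UD: "(U * D l) $$ (i,k) = u k i * l k" if "k < n" for k
    proof -
      have "(U * D l) $$ (i,k) = (\<Sum>m<n. U $$ (i,m) * (if m = k then l m else 0))"
        using ij U(1) D that by (simp add: scalar_prod_def D_def lessThan_atLeast0)
      also have "\<dots> = (\<Sum>m<n. if m = k then U $$ (i,m) * l m else 0)"
        by (intro sum.cong) auto
      finally show ?thesis using that by (simp add: u_def)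
    qed
    have "A $$ (i,j) = (\<Sum>k<n. (U * D l) $$ (i,k) * U $$ (j,k))"
      using ij U(1) D by (subst AU) (simp add: scalar_prod_def lessThan_atLeast0 del: assoc_mult_mat)
    also have "\<dots> = (\<Sum>k<n. l k * u k i * u k j)"
      by (intro sum.cong refl) (simp add: UD, simp add: u_def)
    finally show ?thesis .
  qed
  have Q: "bilin A x x = (\<Sum>k<n. l k * (\<Sum>i<n. u k i * x i)\<^sup>2)" for x
  proof -
    have dim: "dim_row A = n" using A by simp
    have "bilin A x x = (\<Sum>i<n. \<Sum>j<n. \<Sum>k<n. l k * u k i * u k j * x i * x j)"
      unfolding bilin_def dim by (intro sum.cong refl) (simp add: entry sum_distrib_right)
    also have "\<dots> = (\<Sum>i<n. \<Sum>k<n. \<Sum>j<n. l k * u k i * u k j * x i * x j)"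
      by (intro sum.cong refl sum.swap)
    also have "\<dots> = (\<Sum>k<n. \<Sum>i<n. \<Sum>j<n. l k * u k i * u k j * x i * x j)"
      by (rule sum.swap)
    also have "\<dots> = (\<Sum>k<n. l k * (\<Sum>i<n. u k i * x i)\<^sup>2)"
      unfolding power2_eq_square
      by (intro sum.cong refl) (simp add: sum_product sum_distrib_left mult_ac)
    finally show ?thesis .
  qed
  have UtU: "(\<Sum>i<n. u j i * u k i) = (if j = k then 1 else 0)" if "j < n" "k < n" for j k
    using arg_cong[OF U(2), of "\<lambda>M. M $$ (j,k)"] that U(1)
    by (simp add: scalar_prod_def lessThan_atLeast0 u_def)
  have UUt: "(\<Sum>k<n. u k i * u k j) = (if i = j then 1 else 0)" if "i < n" "j < n" for i j
    using arg_cong[OF UUt1, of "\<lambda>M. M $$ (i,j)"] that U(1)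
    by (simp add: scalar_prod_def lessThan_atLeast0 u_def)
  show ?thesis
    by (intro exI[of _ l] exI[of _ u] conjI allI impI num Q UtU UUt)
qed

text \<open>With fewer than m nonpositive eigenvalues, some nontrivial combination x of the
  \<open>f j\<close> is orthogonal to all their eigenvectors. On x the form is a sum of nonnegative
  terms, so being nonpositive it vanishes, and then x = 0 against independence.\<close>

lemma num_nonpos_eigenvalues_ge:
  fixes f :: "nat \<Rightarrow> nat \<Rightarrow> real"
  assumes A: "A \<in> carrier_mat n n" and sym: "transpose_mat A = A"
    and indep: "\<And>c. \<exists>j<m. c j \<noteq> 0 \<Longrightarrow> \<exists>p<n. (\<Sum>j<m. c j * f j p) \<noteq> 0"
    and nonpos: "\<And>c. bilin A (\<lambda>p. \<Sum>j<m. c j * f j p) (\<lambda>p. \<Sum>j<m. c j * f j p) \<le> 0"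
  shows "num_nonpos_eigenvalues A \<ge> m"
proof (rule ccontr)
  obtain l u where num: "num_nonpos_eigenvalues A = card {k. k < n \<and> l k \<le> 0}"
    and Q: "\<And>x. bilin A x x = (\<Sum>k<n. l k * (\<Sum>i<n. u k i * x i)\<^sup>2)"
    and UUt: "\<And>i j. i < n \<Longrightarrow> j < n \<Longrightarrow> (\<Sum>k<n. u k i * u k j) = (if i = j then 1 else 0)"
    using num_nonpos_eigenvalues_diagonalization[OF A sym] by auto
  let ?I = "{k. k < n \<and> l k \<le> 0}"
  assume "\<not> ?thesis"
  then have "card ?I < card {..<m}" using num by simp
  from homogeneous_system_nontrivial[OF _ _ this, of "\<lambda>k j. \<Sum>i<n. u k i * f j i"]
  obtain c where c: "\<exists>j<m. c j \<noteq> 0"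
    and eq: "\<And>k. k < n \<Longrightarrow> l k \<le> 0 \<Longrightarrow> (\<Sum>j<m. (\<Sum>i<n. u k i * f j i) * c j) = 0" by auto
  define x where "x p = (\<Sum>j<m. c j * f j p)" for p
  define z where "z k = (\<Sum>i<n. u k i * x i)" for k
  have "z k = (\<Sum>j<m. (\<Sum>i<n. u k i * f j i) * c j)" for k
    unfolding z_def x_def sum_distrib_left sum_distrib_right
    by (subst sum.swap) (simp add: algebra_simps)
  then have z0: "z k = 0" if "k < n" "l k \<le> 0" for k using eq that by simp
  have nonneg: "l k * (z k)\<^sup>2 \<ge> 0" if "k < n" for k
    using z0[OF that] by (cases "l k \<le> 0") auto
  have "(\<Sum>k<n. l k * (z k)\<^sup>2) \<le> 0"
    using nonpos[of c] Q[of x] unfolding x_def z_def by simp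
  then have "(\<Sum>k<n. l k * (z k)\<^sup>2) = 0"
    using nonneg by (intro antisym sum_nonneg) auto
  then have "l k * (z k)\<^sup>2 = 0" if "k < n" for k
    using nonneg that by (subst (asm) sum_nonneg_eq_0_iff) auto
  then have z: "z k = 0" if "k < n" for k
    using z0[OF that] that by (cases "l k \<le> 0") fastforce+
  \<comment> \<open>Since the eigenvectors form an orthonormal basis, x is recovered from its
    coordinates \<open>z k\<close>, which are all zero.\<close>
  have "x p = 0" if p: "p < n" for p
  proof -
    have "0 = (\<Sum>k<n. u k p * z k)" using z by simp
    also have "\<dots> = (\<Sum>k<n. \<Sum>i<n. u k p * u k i * x i)"
      by (simp add: z_def sum_distrib_left mult.assoc)
    also have "\<dots> = (\<Sum>i<n. \<Sum>k<n. u k p * u k i * x i)" by (rule sum.swap)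
    also have "\<dots> = (\<Sum>i<n. if p = i then x i else 0)"
      by (intro sum.cong refl) (simp add: sum_distrib_right[symmetric] UUt p)
    finally show ?thesis using p by simp
  qed
  then show False using indep[OF c] unfolding x_def by blast
qed

text \<open>Dual to the lower bound: the form is positive definite on the common kernel of m
  functionals. With more than m nonpositive eigenvalues, the span of their eigenvectors would meet
  this kernel in a nonzero vector, where the form is nonpositive.\<close>

lemma num_nonpos_eigenvalues_le:
  fixes f :: "nat \<Rightarrow> nat \<Rightarrow> real"
  assumes A: "A \<in> carrier_mat n n" and sym: "transpose_mat A = A"
    and pos: "\<And>x. \<forall>j<m. (\<Sum>i<n. f j i * x i) = 0 \<Longrightarrow> bilin A x x \<le> 0 \<Longrightarrow> \<forall>p<n. x p = 0"
  shows "num_nonpos_eigenvalues A \<le> m"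
proof (rule ccontr)
  obtain l u where num: "num_nonpos_eigenvalues A = card {k. k < n \<and> l k \<le> 0}"
    and Q: "\<And>x. bilin A x x = (\<Sum>k<n. l k * (\<Sum>i<n. u k i * x i)\<^sup>2)"
    and UtU: "\<And>j k. j < n \<Longrightarrow> k < n \<Longrightarrow> (\<Sum>i<n. u j i * u k i) = (if j = k then 1 else 0)"
    using num_nonpos_eigenvalues_diagonalization[OF A sym] by auto
  let ?I = "{k. k < n \<and> l k \<le> 0}"
  assume "\<not> ?thesis"
  then have "card {..<m} < card ?I" using num by simp
  from homogeneous_system_nontrivial[OF _ _ this, of "\<lambda>j k. \<Sum>i<n. f j i * u k i"]
  obtain c where c: "\<exists>k\<in>?I. c k \<noteq> 0"
    and eq: "\<And>j. j < m \<Longrightarrow> (\<Sum>k\<in>?I. (\<Sum>i<n. f j i * u k i) * c k) = 0" by auto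
  define x where "x i = (\<Sum>k\<in>?I. c k * u k i)" for i
  have "(\<Sum>i<n. f j i * x i) = 0" if "j < m" for j
    using eq[OF that] unfolding x_def sum_distrib_left sum_distrib_right
    by (subst sum.swap) (simp add: algebra_simps)
  moreover have z: "(\<Sum>i<n. u j i * x i) = (if j \<in> ?I then c j else 0)" if j: "j < n" for j
  proof -
    have "(\<Sum>i<n. u j i * x i) = (\<Sum>k\<in>?I. \<Sum>i<n. c k * (u j i * u k i))"
      unfolding x_def sum_distrib_left by (subst sum.swap) (simp add: algebra_simps)
    also have "\<dots> = (\<Sum>k\<in>?I. if j = k then c k else 0)"
      by (intro sum.cong refl) (simp add: sum_distrib_left[symmetric] UtU j)
    finally show ?thesis by simp
  qed
  have "bilin A x x \<le> 0" unfolding Q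
    by (intro sum_nonpos) (auto simp: z mult_nonpos_nonneg)
  ultimately have "\<forall>p<n. x p = 0" using pos by blast
  then have "\<forall>j<n. (\<Sum>i<n. u j i * x i) = 0" by simp
  then show False using c z by force
qed

lemma bilin_sum:
  "bilin A (\<lambda>p. \<Sum>j\<in>J. c j * f j p) (\<lambda>p. \<Sum>k\<in>K. d k * g k p)
    = (\<Sum>j\<in>J. \<Sum>k\<in>K. c j * d k * bilin A (f j) (g k))"
proof -
  let ?n = "dim_row A"
  let ?t = "\<lambda>i m j k. A $$ (i,m) * (c j * f j i) * (d k * g k m)"
  have "bilin A (\<lambda>p. \<Sum>j\<in>J. c j * f j p) (\<lambda>p. \<Sum>k\<in>K. d k * g k p)
      = (\<Sum>i<?n. \<Sum>m<?n. \<Sum>j\<in>J. \<Sum>k\<in>K. ?t i m j k)"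
    unfolding bilin_def
    by (intro sum.cong refl) (simp add: sum_distrib_left sum_distrib_right sum_product mult_ac)
  also have "\<dots> = (\<Sum>j\<in>J. \<Sum>k\<in>K. \<Sum>i<?n. \<Sum>m<?n. ?t i m j k)"
    by (subst (2) sum.swap, subst sum.swap, intro sum.cong refl,
        subst (2) sum.swap, subst sum.swap, rule refl)
  also have "\<dots> = (\<Sum>j\<in>J. \<Sum>k\<in>K. c j * d k * bilin A (f j) (g k))"
    unfolding bilin_def by (intro sum.cong refl) (simp add: sum_distrib_left mult_ac)
  finally show ?thesis .
qed

lemma bilin_commute:
  assumes "A \<in> carrier_mat n n" and "transpose_mat A = A"
  shows "bilin A x y = bilin A y x"
proof -
  have "A $$ (i,j) = A $$ (j,i)" if "i < n" "j < n" for i j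
    using arg_cong[OF assms(2), of "\<lambda>M. M $$ (i,j)"] that assms(1) by simp
  then have "bilin A x y = (\<Sum>i<n. \<Sum>j<n. A $$ (j,i) * x i * y j)"
    using assms(1) unfolding bilin_def by (auto intro!: sum.cong)
  also have "\<dots> = (\<Sum>j<n. \<Sum>i<n. A $$ (j,i) * x i * y j)" by (rule sum.swap)
  finally show ?thesis using assms(1) unfolding bilin_def by (simp add: mult_ac)
qed

text \<open>If the form were nonpositive at \<open>y\<close>, then by orthogonality it would be
  nonpositive on the whole span of \<open>x0\<close>, \<open>x1\<close>, \<open>x2\<close>,
  \<open>y\<close>. That span has dimension 4, which forces four nonpositive eigenvalues. The
  assumption \<open>nonpos\<close> is the form on p \<open>x0\<close> + q \<open>x1\<close> + r
  \<open>x2\<close>, expanded.\<close>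

lemma bilin_pos_if_few_nonpos:
  assumes A: "A \<in> carrier_mat n n" and sym: "transpose_mat A = A"
    and few: "num_nonpos_eigenvalues A < 4"
    and orth: "bilin A x0 y = 0" "bilin A x1 y = 0" "bilin A x2 y = 0"
    and nonpos: "\<And>p q r. p\<^sup>2 * bilin A x0 x0 + q\<^sup>2 * bilin A x1 x1 + r\<^sup>2 * bilin A x2 x2
      + 2 * p * q * bilin A x0 x1 + 2 * p * r * bilin A x0 x2 + 2 * q * r * bilin A x1 x2 \<le> 0"
    and indep: "\<And>p q r s. (\<And>v. v < n \<Longrightarrow> p * x0 v + q * x1 v + r * x2 v + s * y v = 0)
      \<Longrightarrow> p = 0 \<and> q = 0 \<and> r = 0 \<and> s = 0"
  shows "bilin A y y > 0"
proof (rule ccontr)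
  assume neg: "\<not> ?thesis"
  define f where "f j = [x0, x1, x2, y] ! j" for j
  have f: "f 0 = x0" "f 1 = x1" "f 2 = x2" "f 3 = y" by (simp_all add: f_def)
  have set4: "{..<4::nat} = {0,1,2,3}" by auto
  have com: "bilin A u v = bilin A v u" for u v by (rule bilin_commute[OF A sym])
  have "4 \<le> num_nonpos_eigenvalues A"
  proof (rule num_nonpos_eigenvalues_ge[OF A sym, where f = f])
    fix c :: "nat \<Rightarrow> real"
    assume c: "\<exists>j<4. c j \<noteq> 0"
    show "\<exists>p<n. (\<Sum>j<4. c j * f j p) \<noteq> 0"
    proof (rule ccontr)
      assume "\<not> ?thesis"
      then have "c 0 * x0 v + c 1 * x1 v + c 2 * x2 v + c 3 * y v = 0" if "v < n" for v
        using that by (simp add: set4 f add.assoc flip: One_nat_def)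
      from indep[OF this] have "c 0 = 0 \<and> c 1 = 0 \<and> c 2 = 0 \<and> c 3 = 0" by blast
      then show False using c set4 by (metis insert_iff lessThan_iff empty_iff)
    qed
  next
    fix c :: "nat \<Rightarrow> real"
    have "bilin A (\<lambda>p. \<Sum>j<4. c j * f j p) (\<lambda>p. \<Sum>j<4. c j * f j p)
      = ((c 0)\<^sup>2 * bilin A x0 x0 + (c 1)\<^sup>2 * bilin A x1 x1 + (c 2)\<^sup>2 * bilin A x2 x2
        + 2 * c 0 * c 1 * bilin A x0 x1 + 2 * c 0 * c 2 * bilin A x0 x2
        + 2 * c 1 * c 2 * bilin A x1 x2) + (c 3)\<^sup>2 * bilin A y y"
      unfolding bilin_sum
      using orth com[of y x0] com[of y x1] com[of y x2] com[of x1 x0] com[of x2 x0] com[of x2 x1]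
      by (simp add: set4 f power2_eq_square algebra_simps flip: One_nat_def)
    also have "\<dots> \<le> 0"
      using nonpos[of "c 0" "c 1" "c 2"] neg by (simp add: add_nonpos_nonpos mult_nonneg_nonpos)
    finally show "bilin A (\<lambda>p. \<Sum>j<4. c j * f j p) (\<lambda>p. \<Sum>j<4. c j * f j p) \<le> 0" .
  qed
  then show False using few by simp
qed

section \<open>Vectors with explicit finite support\<close>

text \<open>Short lists of vertices with coefficients let the simplifier evaluate the form on
  explicit vectors. Repeated vertices add up, so \<open>@\<close> is vector addition.\<close>

definition comb :: "(nat \<times> real) list \<Rightarrow> nat \<Rightarrow> real" where
  "comb xs p = (\<Sum>(v,c)\<leftarrow>xs. if v = p then c else 0)"

definition gform :: "(nat \<Rightarrow> nat \<Rightarrow> bool) \<Rightarrow> (nat \<times> real) list \<Rightarrow> (nat \<times> real) list \<Rightarrow> real" where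
  "gform E xs ys = (\<Sum>(u,c)\<leftarrow>xs. \<Sum>(v,d)\<leftarrow>ys. c * d * of_bool (E u v))"

definition scale :: "real \<Rightarrow> (nat \<times> real) list \<Rightarrow> (nat \<times> real) list" where
  "scale c xs = map (\<lambda>(v,d). (v, c * d)) xs"

lemma comb_simps [simp]:
  "comb [] p = 0" "comb ((v,c) # xs) p = (if v = p then c else 0) + comb xs p"
  "comb (xs @ ys) p = comb xs p + comb ys p"
  by (simp_all add: comb_def)

lemma comb_scale [simp]: "comb (scale c xs) p = c * comb xs p"
  by (induction xs) (auto simp: scale_def algebra_simps)

lemma gform_append [simp]:
  "gform E (xs @ xs') ys = gform E xs ys + gform E xs' ys"
  "gform E xs (ys @ ys') = gform E xs ys + gform E xs ys'"
  by (simp_all add: gform_def case_prod_unfold sum_list_addf)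

lemma gform_scale [simp]:
  "gform E (scale c xs) ys = c * gform E xs ys" "gform E xs (scale c ys) = c * gform E xs ys"
  by (simp_all add: gform_def scale_def case_prod_unfold sum_list_const_mult[symmetric] o_def mult_ac)

lemma adj_matrix_carrier: "adj_matrix n E \<in> carrier_mat n n"
  by (simp add: adj_matrix_def)

lemma adj_matrix_sym: "simple_graph n E \<Longrightarrow> transpose_mat (adj_matrix n E) = adj_matrix n E"
  by (rule eq_matI) (auto simp: adj_matrix_def simple_graph_def)

text \<open>Bridge from sums over all vertices to sums over list entries. The supports must lie
  below \<open>n\<close>, because \<open>gform\<close> does not see the size of the graph.\<close>

lemma bilin_adj_matrix_comb:
  assumes "fst ` set xs \<subseteq> {..<n}" and "fst ` set ys \<subseteq> {..<n}"
  shows "bilin (adj_matrix n E) (comb xs) (comb ys) = gform E xs ys"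
proof -
  have row: "(\<Sum>j<n. of_bool (E i j) * comb ys j) = (\<Sum>(v,d)\<leftarrow>ys. d * of_bool (E i v))" for i
    using assms(2)
  proof (induction ys)
    case (Cons a ys)
    obtain v d where a: "a = (v,d)" by fastforce
    have "(\<Sum>j<n. of_bool (E i j) * comb (a # ys) j)
        = (\<Sum>j<n. if v = j then d * of_bool (E i j) else 0) + (\<Sum>j<n. of_bool (E i j) * comb ys j)"
      unfolding sum.distrib[symmetric] a by (intro sum.cong refl) (auto simp: algebra_simps)
    also have "(\<Sum>j<n. if v = j then d * of_bool (E i j) else 0) = d * of_bool (E i v)"
      using Cons.prems a by (subst sum.delta') auto
    finally show ?case using Cons a by simp
  qed simp
  have "bilin (adj_matrix n E) (comb xs) (comb ys)
      = (\<Sum>i<n. comb xs i * (\<Sum>j<n. of_bool (E i j) * comb ys j))"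
    unfolding bilin_def sum_distrib_left by (auto simp: adj_matrix_def intro!: sum.cong)
  also have "\<dots> = (\<Sum>i<n. comb xs i * (\<Sum>(v,d)\<leftarrow>ys. d * of_bool (E i v)))" by (simp only: row)
  also have "\<dots> = gform E xs ys"
    using assms(1)
  proof (induction xs)
    case (Cons a xs)
    let ?g = "\<lambda>i. \<Sum>(v,d)\<leftarrow>ys. d * of_bool (E i v)"
    obtain u c where a: "a = (u,c)" by fastforce
    have "(\<Sum>i<n. comb (a # xs) i * ?g i)
        = (\<Sum>i<n. if u = i then c * ?g i else 0) + (\<Sum>i<n. comb xs i * ?g i)"
      unfolding sum.distrib[symmetric] a by (intro sum.cong refl) (auto simp: algebra_simps)
    also have "(\<Sum>i<n. if u = i then c * ?g i else 0) = c * ?g u"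
      using Cons.prems a by (subst sum.delta') auto
    also have "c * ?g u = gform E [a] ys"
      by (simp add: a gform_def case_prod_unfold sum_list_const_mult[symmetric] mult_ac)
    finally show ?case using Cons a gform_append(1)[of E "[a]" xs ys] by simp
  qed (simp add: gform_def)
  finally show ?thesis .
qed

section \<open>Graphs with three independent vertices\<close>

text \<open>The form vanishes identically on the span of the unit vectors at a, b, c, which serves
  as the 3-dimensional subspace of \<open>bilin_pos_if_few_nonpos\<close>. Orthogonality to it means
  that the coefficients in \<open>ys\<close> are a linear relation between adjacency vectors to a,
  b, c.\<close>

lemma gform_pos_off_independent_triple:
  assumes G: "simple_graph n E" and few: "num_nonpos_eigenvalues (adj_matrix n E) < 4"
    and base: "a < n" "b < n" "c < n" "distinct [a,b,c]" "\<not> E a b" "\<not> E a c" "\<not> E b c"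
    and ys: "fst ` set ys \<subseteq> {..<n} - {a,b,c}"
    and orth: "\<And>p. p \<in> {a,b,c} \<Longrightarrow> gform E [(p,1)] ys = 0"
    and nz: "\<exists>v. comb ys v \<noteq> 0"
  shows "gform E ys ys > 0"
proof -
  let ?A = "adj_matrix n E"
  have E: "\<not> E p q" if "p \<in> {a,b,c}" "q \<in> {a,b,c}" for p q
    using that base G unfolding simple_graph_def by auto
  have off: "comb ys p = 0" if "p \<notin> fst ` set ys" for p
    using that by (induction ys) auto
  then obtain v where v: "comb ys v \<noteq> 0" "v \<in> {..<n} - {a,b,c}"
    using nz ys by blast
  have ysn: "fst ` set ys \<subseteq> {..<n}" using ys by auto
  have bil: "bilin ?A (comb [(p,1)]) (comb zs) = gform E [(p,1)] zs"
    if "p \<in> {a,b,c}" "fst ` set zs \<subseteq> {..<n}" for p zs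
    using that base by (intro bilin_adj_matrix_comb) auto
  have iso: "bilin ?A (comb [(p,1)]) (comb [(q,1)]) = 0" if "p \<in> {a,b,c}" "q \<in> {a,b,c}" for p q
    using that base E[OF that] by (subst bil) (auto simp: gform_def)
  have "bilin ?A (comb ys) (comb ys) > 0"
  proof (rule bilin_pos_if_few_nonpos[OF adj_matrix_carrier adj_matrix_sym[OF G] few,
        of "comb [(a,1)]" _ "comb [(b,1)]" "comb [(c,1)]"])
    show "p = 0 \<and> q = 0 \<and> r = 0 \<and> s = 0"
      if *: "\<And>v. v < n \<Longrightarrow> p * comb [(a,1)] v + q * comb [(b,1)] v + r * comb [(c,1)] v
        + s * comb ys v = 0" for p q r s
    proof -
      have "s = 0" using *[of v] v by auto
      then show ?thesis using *[of a] *[of b] *[of c] base by auto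
    qed
  qed (use ysn orth in \<open>simp_all add: iso bil\<close>)
  then show ?thesis using ys by (subst (asm) bilin_adj_matrix_comb) auto
qed

lemma order_le_9_if_independent_triple:
  assumes G: "simple_graph n E" and few: "num_nonpos_eigenvalues (adj_matrix n E) < 4"
    and base: "a < n" "b < n" "c < n" "distinct [a,b,c]" "\<not> E a b" "\<not> E a c" "\<not> E b c"
  shows "n \<le> 9"
proof (rule ccontr)
  assume "\<not> n \<le> 9"
  define V where "V = {..<n} - {a,b,c}"
  define \<tau> where "\<tau> v = (E a v, E b v, E c v)" for v
  have "card {a,b,c} = 3" using base by auto
  then have cardV: "card V \<ge> 7" unfolding V_def using base \<open>\<not> n \<le> 9\<close>
    by (subst card_Diff_subset) auto
  have sym: "E u v = E v u" if "u \<in> V" "v \<in> V" for u v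
    using that G unfolding V_def simple_graph_def by auto
  have irr: "\<not> E u u" if "u \<in> V" for u
    using that G unfolding V_def simple_graph_def by auto
  note pos = gform_pos_off_independent_triple[OF G few base, folded V_def]
  \<comment> \<open>Equal adjacency vectors give the relation u - v, whose value is 0 or -2.\<close>
  have inj: "inj_on \<tau> V"
  proof (rule inj_onI, rule ccontr)
    fix u v assume uv: "u \<in> V" "v \<in> V" "\<tau> u = \<tau> v" "u \<noteq> v"
    have "gform E [(u,1),(v,-1)] [(u,1),(v,-1)] > 0"
      using uv by (intro pos exI[of _ u])
        (auto simp: \<tau>_def gform_def)
    then show False using uv irr
      by (simp add: gform_def sym[of v u] of_bool_def split: if_splits)
  qed
  have nz: "\<tau> u \<noteq> (False,False,False)" if u: "u \<in> V" for u
  proof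
    assume "\<tau> u = (False,False,False)"
    then have "gform E [(u,1)] [(u,1)] > 0"
      using u by (intro pos exI[of _ u]) (auto simp: \<tau>_def gform_def)
    then show False using u irr by (simp add: gform_def)
  qed
  then have sub: "\<tau> ` V \<subseteq> UNIV - {(False,False,False)}"
    by (metis DiffI UNIV_I image_subsetI singletonD)
  have "card (UNIV - {(False,False,False)}) = 7"
    by (simp add: card_Diff_singleton card_cartesian_product flip: UNIV_Times_UNIV)
  \<comment> \<open>At least seven distinct nonzero vectors in {0,1}^3: every one of them
    occurs.\<close>
  then have "\<tau> ` V = UNIV - {(False,False,False)}"
    using sub cardV by (intro card_seteq) (auto simp: card_image[OF inj])
  then have ex: "\<exists>v\<in>V. \<tau> v = t" if "t \<noteq> (False,False,False)" for t
    proof -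
    have "t \<in> \<tau> ` V" using that \<open>\<tau> ` V = _\<close> by simp
    then show ?thesis by auto
  qed
  obtain v1 where v1: "v1 \<in> V" "\<tau> v1 = (True,False,False)" using ex[of "(True,False,False)"] by auto
  obtain v2 where v2: "v2 \<in> V" "\<tau> v2 = (False,True,False)" using ex[of "(False,True,False)"] by auto
  obtain v3 where v3: "v3 \<in> V" "\<tau> v3 = (False,False,True)" using ex[of "(False,False,True)"] by auto
  obtain v12 where v12: "v12 \<in> V" "\<tau> v12 = (True,True,False)" using ex[of "(True,True,False)"] by auto
  obtain v13 where v13: "v13 \<in> V" "\<tau> v13 = (True,False,True)" using ex[of "(True,False,True)"] by auto
  obtain v23 where v23: "v23 \<in> V" "\<tau> v23 = (False,True,True)" using ex[of "(False,True,True)"] by auto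
  obtain w where w: "w \<in> V" "\<tau> w = (True,True,True)" using ex[of "(True,True,True)"] by auto
  \<comment> \<open>The relation x + y - z has value 2 (xy - xz - yz) in edge indicators, which is
    positive only in this one case.\<close>
  have rel3: "E x y \<and> \<not> E x z \<and> \<not> E y z"
    if V: "x \<in> V" "y \<in> V" "z \<in> V" and d: "distinct [x,y,z]"
      and t: "\<And>p. p \<in> {a,b,c} \<Longrightarrow> of_bool (E p x) + of_bool (E p y) = (of_bool (E p z) :: real)"
    for x y z
  proof -
    have "gform E [(p,1)] [(x,1),(y,1),(z,-1)] = 0" if "p \<in> {a,b,c}" for p
      using t[OF that] unfolding gform_def by simp
    from pos[OF _ this exI[of _ x]]
    have "gform E [(x,1),(y,1),(z,-1)] [(x,1),(y,1),(z,-1)] > 0" using V d by auto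
    then show ?thesis using V irr
      by (simp add: gform_def sym[of y x] sym[of z x] sym[of z y] of_bool_def
          split: if_splits)
  qed
  \<comment> \<open>Half the value of the relation x + y - z - t.\<close>
  have rel4: "of_bool (E x y) + of_bool (E z t) - of_bool (E x z) - of_bool (E x t) - of_bool (E y z)
      - of_bool (E y t) > (0::real)"
    if V: "x \<in> V" "y \<in> V" "z \<in> V" "t \<in> V" and d: "distinct [x,y,z,t]"
      and t: "\<And>p. p \<in> {a,b,c} \<Longrightarrow>
        of_bool (E p x) + of_bool (E p y) = (of_bool (E p z) + of_bool (E p t) :: real)"
    for x y z t
  proof -
    have "gform E [(p,1)] [(x,1),(y,1),(z,-1),(t,-1)] = 0" if "p \<in> {a,b,c}" for p
      using t[OF that] unfolding gform_def by simp
    from pos[OF _ this exI[of _ x]]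
    have "gform E [(x,1),(y,1),(z,-1),(t,-1)] [(x,1),(y,1),(z,-1),(t,-1)] > 0" using V d by auto
    then show ?thesis using V irr
      by (simp add: gform_def sym[of y x] sym[of z x] sym[of z y] sym[of t x]
          sym[of t y] sym[of t z])
  qed
  note types = v1 v2 v3 v12 v13 v23 w
  have \<tau>: "E a v1" "\<not> E b v1" "\<not> E c v1" "\<not> E a v2" "E b v2" "\<not> E c v2" "\<not> E a v3" "\<not> E b v3" "E c v3"
    "E a v12" "E b v12" "\<not> E c v12" "E a v13" "\<not> E b v13" "E c v13" "\<not> E a v23" "E b v23" "E c v23"
    "E a w" "E b w" "E c w"
    using types unfolding \<tau>_def by auto
  have neq: "distinct [v1,v2,v3,v12,v13,v23,w]" using \<tau> by auto
  \<comment> \<open>The six ways to write a nonzero 0/1 vector as a sum of two others. The index of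
    each vertex lists the positions of its ones; \<open>w\<close> has all three.\<close>
  have "E v1 v2 \<and> \<not> E v1 v12 \<and> \<not> E v2 v12" "E v1 v3 \<and> \<not> E v1 v13 \<and> \<not> E v3 v13"
    "E v2 v3 \<and> \<not> E v2 v23 \<and> \<not> E v3 v23"
    "E v1 v23 \<and> \<not> E v1 w \<and> \<not> E v23 w" "E v2 v13 \<and> \<not> E v2 w \<and> \<not> E v13 w"
    "E v3 v12 \<and> \<not> E v3 w \<and> \<not> E v12 w"
    by (rule rel3; use types neq \<tau> in auto)+
  note C = this
  \<comment> \<open>In the relation \<open>v12\<close> + \<open>v13\<close> = \<open>w\<close> +
    \<open>v1\<close> every indicator except the first is already known to be 0.\<close>
  have "of_bool (E v12 v13) + of_bool (E w v1) - of_bool (E v12 w) - of_bool (E v12 v1)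
      - of_bool (E v13 w) - of_bool (E v13 v1) > (0::real)"
    by (rule rel4; use types neq \<tau> in auto)
  then have C': "E v12 v13"
    using C sym[OF w(1) v1(1)] sym[OF v12(1) v1(1)] sym[OF v13(1) v1(1)]
    by (cases "E v12 v13") simp_all
  \<comment> \<open>The contradiction: for \<open>v2\<close> + \<open>v13\<close> =
    \<open>v3\<close> + \<open>v12\<close> all indicators are now known and give 1 + 1 - 1 - 0 - 0 -
    1 = 0.\<close>
  have "of_bool (E v2 v13) + of_bool (E v3 v12) - of_bool (E v2 v3) - of_bool (E v2 v12)
      - of_bool (E v13 v3) - of_bool (E v13 v12) > (0::real)"
    by (rule rel4; use types neq \<tau> in auto)
  then show False
    using C C' sym[OF v13(1) v12(1)] sym[OF v13(1) v3(1)] by simp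
qed

section \<open>Graphs with a four-clique\<close>

lemma three_elements:
  assumes "card S \<ge> 3"
  obtains x y z where "x \<in> S" "y \<in> S" "z \<in> S" "x \<noteq> y" "x \<noteq> z" "y \<noteq> z"
proof -
  obtain T where "T \<subseteq> S" "card T = 3" using obtain_subset_with_card_n[OF assms] by metis
  then show ?thesis using that unfolding card_3_iff by blast
qed

text \<open>For a four-clique K, whose adjacency matrix J - I has inverse J/3 - I, this is the Schur
  complement of K in the adjacency matrix of the graph.\<close>
definition clique_form :: "(nat \<Rightarrow> nat \<Rightarrow> bool) \<Rightarrow> nat set \<Rightarrow> nat \<Rightarrow> nat \<Rightarrow> real" where
  "clique_form E K u v = of_bool (E u v) + (\<Sum>p\<in>K. of_bool (E p u) * of_bool (E p v))
     - (\<Sum>p\<in>K. of_bool (E p u)) * (\<Sum>p\<in>K. of_bool (E p v)) / 3"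

text \<open>On the vectors supported on K with coordinate sum 0 the form J - I is minus the squared
  norm. The differences a - b, b - c, c - d span them and serve as the 3-dimensional subspace of
  \<open>bilin_pos_if_few_nonpos\<close>. Combinations of the vectors \<open>g\<close> are
  orthogonal to it, and their Gram matrix is \<open>M\<close>.\<close>

lemma clique_form_pos:
  assumes G: "simple_graph n E" and few: "num_nonpos_eigenvalues (adj_matrix n E) < 4"
    and base: "a < n" "b < n" "c < n" "d < n" "distinct [a,b,c,d]"
      "E a b" "E a c" "E a d" "E b c" "E b d" "E c d"
    and uvw: "{u,v,w} \<subseteq> {..<n} - {a,b,c,d}" "distinct [u,v,w]"
    and nz: "x \<noteq> 0 \<or> y \<noteq> 0 \<or> z \<noteq> 0"
  defines "M \<equiv> clique_form E {a,b,c,d}"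
  shows "x\<^sup>2 * M u u + y\<^sup>2 * M v v + z\<^sup>2 * M w w + 2 * x * y * M u v + 2 * x * z * M u w
    + 2 * y * z * M v w > 0"
proof -
  let ?A = "adj_matrix n E"
  \<comment> \<open>A third of the number of neighbours in K. The coefficients of \<open>g v\<close>
    on K are minus J/3 - I applied to the adjacency vector of v.\<close>
  define t where "t v = (of_bool (E a v) + of_bool (E b v) + of_bool (E c v) + of_bool (E d v)) / (3::real)" for v
  have t: "of_bool (E d v) = 3 * t v - of_bool (E a v) - of_bool (E b v) - of_bool (E c v)" for v
    by (simp add: t_def)
  define g where "g v = [(v, 1), (a, of_bool (E a v) - t v), (b, of_bool (E b v) - t v),
    (c, of_bool (E c v) - t v), (d, of_bool (E d v) - t v)]" for v
  \<comment> \<open>g v is the projection of the unit vector at v onto the orthogonal complement of K's unit vectors.\<close>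
  define ys where "ys = scale x (g u) @ scale y (g v) @ scale z (g w)"
  have ys: "fst ` set ys \<subseteq> {..<n}" using uvw base by (auto simp: ys_def g_def scale_def)
  have K: "E b a" "E c a" "E d a" "E c b" "E d b" "E d c" "\<not> E a a" "\<not> E b b" "\<not> E c c" "\<not> E d d"
    using G base unfolding simple_graph_def by auto
  let ?V = "{..<n} - {a,b,c,d}"
  have base_sym: "E p a = E a p" "E p b = E b p" "E p c = E c p" "E p d = E d p" if "p \<in> ?V" for p
    using that G base unfolding simple_graph_def by auto
  have sum_base: "(\<Sum>p\<in>{a,b,c,d}. f p) = f a + f b + f c + f d" for f :: "nat \<Rightarrow> real"
    using base by (simp add: add.assoc)
  have gg: "gform E (g p) (g q) = M p q" if "p \<in> ?V" "q \<in> ?V" for p q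
    unfolding g_def M_def clique_form_def gform_def sum_base
    by (simp only: list.map sum_list.Cons sum_list.Nil prod.case base_sym[OF that(1)]
          base_sym[OF that(2)] K base of_bool_eq simp_thms)
      (simp only: t, simp add: algebra_simps)
  have diff: "gform E [(a,1),(b,-1)] (g p) = 0" "gform E [(b,1),(c,-1)] (g p) = 0"
    "gform E [(c,1),(d,-1)] (g p) = 0" for p
    by (simp_all add: gform_def g_def K base t)
  have Muv: "M p q = M q p" if "p \<in> ?V" "q \<in> ?V" for p q
    using G that unfolding simple_graph_def M_def clique_form_def by (simp add: mult.commute)
  have "bilin ?A (comb ys) (comb ys) > 0"
  proof (rule bilin_pos_if_few_nonpos[OF adj_matrix_carrier adj_matrix_sym[OF G] few,
        of "comb [(a,1),(b,-1)]" _ "comb [(b,1),(c,-1)]" "comb [(c,1),(d,-1)]"])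
    show "p = 0 \<and> q = 0 \<and> r = 0 \<and> m = 0"
      if *: "\<And>v. v < n \<Longrightarrow> p * comb [(a,1),(b,-1)] v + q * comb [(b,1),(c,-1)] v
        + r * comb [(c,1),(d,-1)] v + m * comb ys v = 0" for p q r m
    proof -
      have "comb ys u = x" "comb ys v = y" "comb ys w = z"
        using uvw unfolding ys_def g_def by auto
      then have "m = 0" using *[of u] *[of v] *[of w] uvw nz by auto
      then show ?thesis using *[of a] *[of b] *[of c] *[of d] base by auto
    qed
    show "p\<^sup>2 * bilin ?A (comb [(a,1),(b,-1)]) (comb [(a,1),(b,-1)])
      + q\<^sup>2 * bilin ?A (comb [(b,1),(c,-1)]) (comb [(b,1),(c,-1)])
      + r\<^sup>2 * bilin ?A (comb [(c,1),(d,-1)]) (comb [(c,1),(d,-1)])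
      + 2 * p * q * bilin ?A (comb [(a,1),(b,-1)]) (comb [(b,1),(c,-1)])
      + 2 * p * r * bilin ?A (comb [(a,1),(b,-1)]) (comb [(c,1),(d,-1)])
      + 2 * q * r * bilin ?A (comb [(b,1),(c,-1)]) (comb [(c,1),(d,-1)]) \<le> 0" (is "?L \<le> 0") for p q r
    proof -
      \<comment> \<open>The combination has coordinates p, q - p, r - q, -r on a, b, c, d.\<close>
      have "?L = - (p\<^sup>2 + (p - q)\<^sup>2 + (q - r)\<^sup>2 + r\<^sup>2)"
        using base by (simp add: bilin_adj_matrix_comb gform_def K)
          (simp add: power2_eq_square algebra_simps)
      moreover have "0 \<le> p\<^sup>2 + (p - q)\<^sup>2 + (q - r)\<^sup>2 + r\<^sup>2" by simp
      ultimately show ?thesis by linarith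
    qed
  qed (use ys base diff in \<open>auto simp: bilin_adj_matrix_comb ys_def\<close>)
  then have "gform E ys ys > 0" using ys by (simp add: bilin_adj_matrix_comb)
  then show ?thesis unfolding ys_def
    using Muv[of v u] Muv[of w u] Muv[of w v] uvw
    by (simp add: gg power2_eq_square algebra_simps)
qed

lemma order_le_6_if_four_clique:
  assumes G: "simple_graph n E" and few: "num_nonpos_eigenvalues (adj_matrix n E) < 4"
    and base: "a < n" "b < n" "c < n" "d < n" "distinct [a,b,c,d]"
      "E a b" "E a c" "E a d" "E b c" "E b d" "E c d"
  shows "n \<le> 6"
proof (rule ccontr)
  assume n: "\<not> n \<le> 6"
  let ?K = "{a,b,c,d}"
  let ?M = "clique_form E ?K"
  define s where "s v = (\<Sum>p\<in>?K. of_bool (E p v) :: real)" for v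
  have "card ?K = 4" using base by auto
  then have "card ({..<n} - ?K) \<ge> 3" using base n by (subst card_Diff_subset) auto
  then obtain u v w where uvw: "u \<in> {..<n} - ?K" "v \<in> {..<n} - ?K" "w \<in> {..<n} - ?K"
    "u \<noteq> v" "u \<noteq> w" "v \<noteq> w"
    by (rule three_elements)
  note pos = clique_form_pos[OF G few base]
  \<comment> \<open>A vertex with s neighbours in K has diagonal entry s (3 - s) / 3, which is
    positive only for s = 1 and s = 2.\<close>
  have diag: "?M p p = 2/3 \<and> s p \<in> {1,2}" if p: "p \<in> {u,v,w}" for p
  proof -
    have "?M p p > 0"
      using pos[of u v w 1 0 0] pos[of u v w 0 1 0] pos[of u v w 0 0 1] uvw p by auto
    moreover have "\<not> E p p" using p uvw G unfolding simple_graph_def by auto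
    ultimately show ?thesis using base unfolding clique_form_def s_def
      by (cases "E a p"; cases "E b p"; cases "E c p"; cases "E d p") auto
  qed
  \<comment> \<open>Evaluating the form at (1,1,0) and (1,-1,0) gives 4/3 + 2 M > 0 and 4/3 - 2 M >
    0.\<close>
  have abs: "\<bar>?M p q\<bar> < 2/3" if pq: "p \<in> {u,v,w}" "q \<in> {u,v,w}" "p \<noteq> q" for p q
  proof -
    obtain r where r: "r \<in> {u,v,w}" "r \<noteq> p" "r \<noteq> q" using pq uvw by auto
    show ?thesis
      using pos[of p q r 1 1 0] pos[of p q r 1 "-1" 0] diag[OF pq(1)] diag[OF pq(2)] pq r uvw
      by auto
  qed
  have off: "?M p q = (if s p = s q then - 1/3 else 1/3)"
    if pq: "p \<in> {u,v,w}" "q \<in> {u,v,w}" "p \<noteq> q" for p q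
  proof -
    \<comment> \<open>The entry differs from -\<open>s p\<close> \<open>s q\<close> / 3 by the
      integer \<open>k\<close>, and the open interval from -2/3 to 2/3 leaves only one choice of
      \<open>k\<close> for each product 1, 2, 4.\<close>
    define k :: int where "k = of_bool (E p q) + (\<Sum>r\<in>?K. of_bool (E r p) * of_bool (E r q))"
    have M: "?M p q = of_int k - s p * s q / 3"
      unfolding clique_form_def k_def s_def by simp
    have sp: "s p = 1 \<or> s p = 2" and sq: "s q = 1 \<or> s q = 2" using diag pq by auto
    from sp sq show ?thesis
    proof (elim disjE)
      assume *: "s p = 1" "s q = 1"
      have "-1 < real_of_int k" "real_of_int k < 1"
        using abs[OF pq] unfolding M * abs_less_iff by linarith+
      then have "k = 0" by linarith
      then show ?thesis using * M by simp
    next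
      assume *: "s p = 1" "s q = 2"
      have "0 < real_of_int k" "real_of_int k < 2"
        using abs[OF pq] unfolding M * abs_less_iff by linarith+
      then have "k = 1" by linarith
      then show ?thesis using * M by simp
    next
      assume *: "s p = 2" "s q = 1"
      have "0 < real_of_int k" "real_of_int k < 2"
        using abs[OF pq] unfolding M * abs_less_iff by linarith+
      then have "k = 1" by linarith
      then show ?thesis using * M by simp
    next
      assume *: "s p = 2" "s q = 2"
      have "0 < real_of_int k" "real_of_int k < 2"
        using abs[OF pq] unfolding M * abs_less_iff by linarith+
      then have "k = 1" by linarith
      then show ?thesis using * M by simp
    qed
  qed
  \<comment> \<open>Changing signs by the value of \<open>s\<close> turns all off-diagonal entries
    into -1/3. The matrix becomes (3 I - J) / 3, which kills the all-ones vector; the form at the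
    vector of signs is therefore 0.\<close>
  define \<epsilon> :: "nat \<Rightarrow> real" where "\<epsilon> p = (if s p = 1 then 1 else -1)" for p
  have "\<epsilon> p * \<epsilon> q * ?M p q = - 1/3" if "p \<in> {u,v,w}" "q \<in> {u,v,w}" "p \<noteq> q" for p q
    using off[OF that] diag[OF that(1)] diag[OF that(2)] unfolding \<epsilon>_def by auto
  from this[of u v] this[of u w] this[of v w]
  have "2 * \<epsilon> u * \<epsilon> v * ?M u v = - 2/3" "2 * \<epsilon> u * \<epsilon> w * ?M u w = - 2/3"
    "2 * \<epsilon> v * \<epsilon> w * ?M v w = - 2/3"
    using uvw by (auto simp: mult.assoc)
  moreover have "(\<epsilon> p)\<^sup>2 = 1" for p unfolding \<epsilon>_def by simp
  ultimately show False
    using pos[of u v w "\<epsilon> u" "\<epsilon> v" "\<epsilon> w"] uvw diag[of u] diag[of v] diag[of w]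
    by (auto simp: \<epsilon>_def split: if_splits)
qed

section \<open>The value of NPO(4)\<close>

text \<open>The recursion R(4,3) <= R(3,3) + R(4,2) = 6 + 4: any vertex \<open>o'\<close> has six
  neighbours or four non-neighbours. Four non-neighbours form a clique, unless two of them are
  independent together with \<open>o'\<close>. Among six neighbours the argument for R(3,3) yields
  an independent triple, or a triangle that \<open>o'\<close> extends to a four-clique.\<close>

lemma four_clique_or_three_independent:
  assumes "finite V" and card: "card V \<ge> 10"
    and sym: "\<And>x y. x \<in> V \<Longrightarrow> y \<in> V \<Longrightarrow> E x y = E y x"
  obtains a b c d where "{a,b,c,d} \<subseteq> V" "distinct [a,b,c,d]" "E a b" "E a c" "E a d" "E b c" "E b d" "E c d"
    | a b c where "{a,b,c} \<subseteq> V" "distinct [a,b,c]" "\<not> E a b" "\<not> E a c" "\<not> E b c"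
proof -
  note clique = that(1) and indep = that(2) and fin = \<open>finite V\<close>
  obtain o' where o: "o' \<in> V" using card by fastforce
  let ?N = "{v \<in> V - {o'}. E o' v}" and ?M = "{v \<in> V - {o'}. \<not> E o' v}"
  have "card (?N \<union> ?M) = card ?N + card ?M" using fin by (intro card_Un_disjoint) auto
  moreover have "?N \<union> ?M = V - {o'}" by auto
  ultimately have "card ?N \<ge> 6 \<or> card ?M \<ge> 4" using card o fin by (simp add: card_Diff_singleton) linarith
  then show thesis
  proof
    assume M: "card ?M \<ge> 4"
    then obtain x where x: "x \<in> ?M" by (metis card.empty ex_in_conv not_numeral_le_zero)
    from M have "card (?M - {x}) \<ge> 3" using x fin by simp
    then obtain y z w where yzw: "y \<in> ?M - {x}" "z \<in> ?M - {x}" "w \<in> ?M - {x}" "y \<noteq> z" "y \<noteq> w" "z \<noteq> w"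
      by (rule three_elements)
    show thesis
    proof (rule ccontr)
      assume no: "\<not> thesis"
      have edge: "E p q" if "p \<in> ?M" "q \<in> ?M" "p \<noteq> q" for p q
        by (rule ccontr, rule notE[OF no], rule indep[of o' p q]) (use that o in auto)
      have "E x y" "E x z" "E x w" "E y z" "E y w" "E z w"
        by (rule edge; use x yzw in blast)+
      with x yzw have "thesis" by (intro clique[of x y z w]) auto
      with no show False ..
    qed
  next
    assume N: "card ?N \<ge> 6"
    then obtain x where x: "x \<in> ?N" by (metis card.empty ex_in_conv not_numeral_le_zero)
    let ?P = "{v \<in> ?N - {x}. E x v}" and ?Q = "{v \<in> ?N - {x}. \<not> E x v}"
    have "card ?P + card ?Q = card (?P \<union> ?Q)" using fin by (subst card_Un_disjoint) auto
    also have "?P \<union> ?Q = ?N - {x}" by auto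
    finally have "card ?P + card ?Q = card (?N - {x})" .
    moreover have "card (?N - {x}) \<ge> 5" using N x fin by simp
    ultimately have "card ?P \<ge> 3 \<or> card ?Q \<ge> 3" by linarith
    then show thesis
    proof
      assume "card ?P \<ge> 3"
      then obtain y z w where yzw: "y \<in> ?P" "z \<in> ?P" "w \<in> ?P" "y \<noteq> z" "y \<noteq> w" "z \<noteq> w"
        by (rule three_elements)
      show thesis
      proof (rule ccontr)
        assume no: "\<not> thesis"
        have nonedge: "\<not> E p q" if "p \<in> ?P" "q \<in> ?P" "p \<noteq> q" for p q
          by (rule notI, rule notE[OF no], rule clique[of o' x p q]) (use that o x in auto)
        have "\<not> E y z" "\<not> E y w" "\<not> E z w"
          by (rule nonedge; use yzw in blast)+
        with yzw have "thesis" by (intro indep[of y z w]) auto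
        with no show False ..
      qed
    next
      assume "card ?Q \<ge> 3"
      then obtain y z w where yzw: "y \<in> ?Q" "z \<in> ?Q" "w \<in> ?Q" "y \<noteq> z" "y \<noteq> w" "z \<noteq> w"
        by (rule three_elements)
      show thesis
      proof (rule ccontr)
        assume no: "\<not> thesis"
        have edge: "E p q" if "p \<in> ?Q" "q \<in> ?Q" "p \<noteq> q" for p q
          by (rule ccontr, rule notE[OF no], rule indep[of x p q]) (use that x in auto)
        have "E y z" "E y w" "E z w"
          by (rule edge; use yzw in blast)+
        with o yzw have "thesis" by (intro clique[of o' y z w]) auto
        with no show False ..
      qed
    qed
  qed
qed

lemma npo_property_4_10: "npo_property 4 10"
  unfolding npo_property_def
proof (intro allI impI, rule ccontr)
  fix m E assume m: "10 \<le> m" and G: "simple_graph m E"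
    and "\<not> 4 \<le> num_nonpos_eigenvalues (adj_matrix m E)"
  then have few: "num_nonpos_eigenvalues (adj_matrix m E) < 4" by simp
  have sym: "E x y = E y x" if "x \<in> {..<m}" "y \<in> {..<m}" for x y
    using that G unfolding simple_graph_def by auto
  from m have card: "card {..<m} \<ge> 10" by simp
  show False
  proof (rule four_clique_or_three_independent[OF _ card sym])
    fix a b c d assume "{a,b,c,d} \<subseteq> {..<m}" "distinct [a,b,c,d]"
      "E a b" "E a c" "E a d" "E b c" "E b d" "E c d"
    then show False using order_le_6_if_four_clique[OF G few, of a b c d] m by simp
  next
    fix a b c assume "{a,b,c} \<subseteq> {..<m}" "distinct [a,b,c]" "\<not> E a b" "\<not> E a c" "\<not> E b c"
    then show False using order_le_9_if_independent_triple[OF G few, of a b c] m by simp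
  qed auto
qed

section \<open>Lower bound: a graph on nine vertices with at most three nonpositive
  eigenvalues\<close>

definition extremal_graph :: "nat \<Rightarrow> nat \<Rightarrow> bool" where
  "extremal_graph i j \<longleftrightarrow> (min i j, max i j) \<in> {(0,1), (0,4), (0,5), (1,6), (1,7), (2,3), (2,4), (2,6),
     (3,5), (3,7), (4,7), (4,8), (5,6), (5,8), (6,8), (7,8)}"

lemma extremal_graph_simple: "simple_graph n extremal_graph"
  unfolding simple_graph_def extremal_graph_def by (auto simp: min.commute max.commute)

text \<open>The three functionals solve for x 4, x 5, x 7; they span the same space as three differences
  of rows of the adjacency matrix along disjoint edges, whose unit vector differences span a
  negative definite subspace. Completing squares on their common kernel gives the sum of squares.\<close>
lemma extremal_graph_num_nonpos: "num_nonpos_eigenvalues (adj_matrix 9 extremal_graph) \<le> 3"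
proof (rule num_nonpos_eigenvalues_le[OF adj_matrix_carrier adj_matrix_sym[OF extremal_graph_simple],
      where f = "\<lambda>j i. [[0,1,2,-1,-1,0,-2,0,1], [1,-1,-1,1,0,-1,1,0,0], [-1,2,1,0,0,0,-2,-1,1]] ! j ! i"])
  have set9: "{..<9::nat} = {0,1,2,3,4,5,6,7,8}" by auto
  fix x :: "nat \<Rightarrow> real"
  assume "\<forall>j<3. (\<Sum>i<9. [[0,1,2,-1,-1,0,-2,0,1], [1,-1,-1,1,0,-1,1,0,0],
      [-1,2,1,0,0,0,-2,-1,1]] ! j ! i * x i) = 0"
  then have eqs: "(\<Sum>i<9. [0,1,2,-1,-1,0,-2,0,1] ! i * x i) = 0"
    "(\<Sum>i<9. [1,-1,-1,1,0,-1,1,0,0] ! i * x i) = 0" "(\<Sum>i<9. [-1,2,1,0,0,0,-2,-1,1] ! i * x i) = 0"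
    by (auto dest: spec[of _ 0] spec[of _ 1] spec[of _ 2])
  from eqs have x4: "x 4 = x 1 + 2 * x 2 - x 3 - 2 * x 6 + x 8" by (simp add: set9)
  from eqs have x5: "x 5 = x 0 - x 1 - x 2 + x 3 + x 6" by (simp add: set9)
  from eqs have x7: "x 7 = - x 0 + 2 * x 1 + x 2 - 2 * x 6 + x 8" by (simp add: set9)
  assume le: "bilin (adj_matrix 9 extremal_graph) x x \<le> 0"
  have "bilin (adj_matrix 9 extremal_graph) x x = 2 * (x 0 * x 1 + x 0 * x 4 + x 0 * x 5 + x 1 * x 6
    + x 1 * x 7 + x 2 * x 3 + x 2 * x 4 + x 2 * x 6 + x 3 * x 5 + x 3 * x 7 + x 4 * x 7 + x 4 * x 8
    + x 5 * x 6 + x 5 * x 8 + x 6 * x 8 + x 7 * x 8)"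
    unfolding bilin_def by (simp add: adj_matrix_def set9 extremal_graph_def algebra_simps)
  also have "\<dots> = 6 * (x 8 - x 6 + x 2 + x 1)\<^sup>2 + (2 * x 6 + x 3 - x 2 - x 1 + x 0)\<^sup>2
    + (x 0)\<^sup>2 + (x 1)\<^sup>2 + (x 2)\<^sup>2 + (x 3)\<^sup>2"
    unfolding x4 x5 x7 by (simp add: power2_eq_square algebra_simps)
  finally have sum: "6 * (x 8 - x 6 + x 2 + x 1)\<^sup>2 + (2 * x 6 + x 3 - x 2 - x 1 + x 0)\<^sup>2
    + (x 0)\<^sup>2 + (x 1)\<^sup>2 + (x 2)\<^sup>2 + (x 3)\<^sup>2 \<le> 0" using le by simp
  note sq = zero_le_power2[of "x 8 - x 6 + x 2 + x 1"]
    zero_le_power2[of "2 * x 6 + x 3 - x 2 - x 1 + x 0"]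
    zero_le_power2[of "x 0"] zero_le_power2[of "x 1"] zero_le_power2[of "x 2"] zero_le_power2[of "x 3"]
  \<comment> \<open>The last four squares give x 0 = ... = x 3 = 0, the second then x 6 = 0 and the
    first x 8 = 0. The solved equations supply x 4, x 5, x 7.\<close>
  have "(x 8 - x 6 + x 2 + x 1)\<^sup>2 = 0" "(2 * x 6 + x 3 - x 2 - x 1 + x 0)\<^sup>2 = 0"
    "(x 0)\<^sup>2 = 0" "(x 1)\<^sup>2 = 0" "(x 2)\<^sup>2 = 0" "(x 3)\<^sup>2 = 0"
    using sum sq by linarith+
  then have "\<forall>p\<in>{..<9}. x p = 0" using x4 x5 x7 unfolding set9 by simp
  then show "\<forall>p<9. x p = 0" by simp
qed

theorem mainTheorem8:
  shows "npo_property 4 10 \<and> NPO 4 = 10"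
proof -
  \<comment> \<open>The property at n covers every order m >= n, so a single graph of order 9
    excludes all n <= 9.\<close>
  have "10 \<le> n" if "npo_property 4 n" for n
  proof (rule ccontr)
    assume "\<not> 10 \<le> n"
    then have "4 \<le> num_nonpos_eigenvalues (adj_matrix 9 extremal_graph)"
      using that extremal_graph_simple unfolding npo_property_def by simp
    then show False using extremal_graph_num_nonpos by simp
  qed
  then have "NPO 4 = 10"
    unfolding NPO_def using npo_property_4_10 by (intro Least_equality)
  then show ?thesis using npo_property_4_10 by simp
qed

end
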